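(* Let $\Omega \subset \mathbb{R}^n$ be an open, bounded, connected domain with $C^2$ boundary. Let $p \in (1,2]$, let $f \in C^1(\overline{\Omega})$ be semiconcave in $\Omega$, and let $H(x,\beta) = |\beta|^p - f(x)$. Assume (1) $f(x) = \min_{y\in \overline{\Omega}}f(y)$ for all $x \in \partial \Omega$; (2) $f(x) > \min_{y\in \overline{\Omega}}f(y)$ for all $x \in \Omega$; (3) there exists a constant $C>0$ such that $|Df(x)| \leq C \left(f(x)-\min_{y\in \overline{\Omega}}f(y)\right)^{1/p}$ for all $x \in \Omega$. Let $u$ be the constrained viscosity solution of $$u+H(x,Du)\le 0 \ \text{ in } \Omega,\qquad u+H(x,Du)\ge 0\ \text{ on } \overline{\Omega}.$$ Then there is a constant $\tilde{C}$ such that $-D^2u\ge-\tilde{C}\,\mathrm{I}_n$ in $\Omega$ in the viscosity sense and, with this same constant, $$u(x+h)-2u(x)+u(x-h) \leq \tilde{C} |h|^2$$ for all $x, h \in \mathbb{R}^n$ such that $[x-h, x+h] \subset \Omega$.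
   Context: $[x-h,x+h]=\{x+sh:-1\le s\le 1\}$, and $\mathrm{I}_n$ is the $n\times n$ identity matrix. A function $g$ is semiconcave in an open set $\Omega$ if there is a constant $K\ge 0$ with $g(x+h)+g(x-h)-2g(x)\le K|h|^2$ for all $x,h\in\mathbb{R}^n$ with $[x-h,x+h]\subset\Omega$. Constrained viscosity solution: $u\in C(\overline{\Omega})$ is the constrained viscosity solution of $u+H(x,Du)\le 0$ in $\Omega$, $u+H(x,Du)\ge 0$ on $\overline{\Omega}$ if (i) whenever $\phi$ is $C^1$ and $u-\phi$ has a local maximum at $x_0\in\Omega$, then $u(x_0)+H(x_0,D\phi(x_0))\le 0$; and (ii) whenever $\phi\in C^1(\overline{\Omega})$ and $u-\phi$ has a local minimum relative to $\overline{\Omega}$ at $x_0\in\overline{\Omega}$ (boundary points allowed), then $u(x_0)+H(x_0,D\phi(x_0))\ge 0$. Under the present hypotheses it exists and is unique. Viscosity inequality: $-D^2u\ge -\tilde{C}\,\mathrm{I}_n$ in $\Omega$ in the viscosity sense means that whenever $\phi$ is a smooth function in $\Omega$ such that $u-\phi$ has a local minimum at $x\in\Omega$, one has $D^2\phi(x)\le\tilde{C}\,\mathrm{I}_n$. *)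

theory Defs
  imports "HOL-Analysis.Analysis"
begin

definition grad :: "(real^'n \<Rightarrow> real) \<Rightarrow> real^'n \<Rightarrow> real^'n" where
  "grad g x = (\<chi> i. frechet_derivative g (at x) (axis i 1))"

definition hessian :: "(real^'n \<Rightarrow> real) \<Rightarrow> real^'n \<Rightarrow> real^'n^'n" where
  "hessian g x = matrix (frechet_derivative (grad g) (at x))"

lemma grad_eq:
  assumes "GDERIV g x :> D"
  shows "grad g x = D"
proof -
  have "frechet_derivative g (at x) = (\<lambda>h. h \<bullet> D)"
    using frechet_derivative_at[of g _ x] assms unfolding gderiv_def by metis
  then show ?thesis
    by (simp add: grad_def vec_eq_iff inner_axis')
qed

text \<open>The notions below are meant for open \<^term>\<open>S\<close>.\<close>

primrec Ck_on :: "nat \<Rightarrow> (real^'n) set \<Rightarrow> (real^'n \<Rightarrow> real) \<Rightarrow> bool" where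
  "Ck_on 0 S g \<longleftrightarrow> continuous_on S g"
| "Ck_on (Suc k) S g \<longleftrightarrow>
     (\<forall>x\<in>S. g differentiable at x) \<and> (\<forall>i. Ck_on k S (\<lambda>x. grad g x $ i))"

definition smooth_on :: "(real^'n) set \<Rightarrow> (real^'n \<Rightarrow> real) \<Rightarrow> bool" where
  "smooth_on S g \<longleftrightarrow> (\<forall>k. Ck_on k S g)"

text \<open>
  \<open>g\<close> is of class \<open>C\<^sup>1\<close> on the closure of the open set \<open>\<Omega>\<close>: it is \<open>C\<^sup>1\<close> in \<open>\<Omega>\<close>, and \<open>g\<close> and its
  gradient extend continuously to the closure. The field \<open>G\<close> is that (unique) extension of the
  gradient, and supplies the value of the gradient at boundary points.
\<close>

definition C1_closure ::
    "(real^'n) set \<Rightarrow> (real^'n \<Rightarrow> real) \<Rightarrow> (real^'n \<Rightarrow> real^'n) \<Rightarrow> bool" where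
  "C1_closure \<Omega> g G \<longleftrightarrow>
     continuous_on (closure \<Omega>) g \<and> continuous_on (closure \<Omega>) G \<and>
     (\<forall>x\<in>\<Omega>. GDERIV g x :> G x)"

text \<open>
  Near each boundary point the set is the part of a ball lying above a \<open>C\<^sup>2\<close> graph, in rotated
  coordinates whose last axis is the unit vector \<open>e\<close>. The argument
  \<open>x - (x \<bullet> e) e\<close> is the projection of \<open>x\<close> to the hyperplane orthogonal to \<open>e\<close>, so \<open>\<gamma>\<close> only
  matters on that hyperplane; taking it to be defined on the whole space avoids a type of
  dimension \<open>n - 1\<close>.
\<close>

definition C2_boundary :: "(real^'n) set \<Rightarrow> bool" where
  "C2_boundary \<Omega> \<longleftrightarrow>
     (\<forall>x0\<in>frontier \<Omega>. \<exists>r>0. \<exists>e \<gamma>. norm e = 1 \<and> Ck_on 2 UNIV \<gamma> \<and>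
        \<Omega> \<inter> ball x0 r = {x \<in> ball x0 r. \<gamma> (x - (x \<bullet> e) *\<^sub>R e) < x \<bullet> e})"

definition semiconcave_in :: "(real^'n) set \<Rightarrow> (real^'n \<Rightarrow> real) \<Rightarrow> bool" where
  "semiconcave_in \<Omega> g \<longleftrightarrow>
     (\<exists>K\<ge>0. \<forall>x h. closed_segment (x - h) (x + h) \<subseteq> \<Omega> \<longrightarrow>
        g (x + h) + g (x - h) - 2 * g x \<le> K * (norm h)\<^sup>2)"

definition local_max_rel :: "(real^'n) set \<Rightarrow> (real^'n \<Rightarrow> real) \<Rightarrow> real^'n \<Rightarrow> bool" where
  "local_max_rel S g x0 \<longleftrightarrow> x0 \<in> S \<and> (\<forall>\<^sub>F y in at x0 within S. g y \<le> g x0)"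

definition local_min_rel :: "(real^'n) set \<Rightarrow> (real^'n \<Rightarrow> real) \<Rightarrow> real^'n \<Rightarrow> bool" where
  "local_min_rel S g x0 \<longleftrightarrow> x0 \<in> S \<and> (\<forall>\<^sub>F y in at x0 within S. g x0 \<le> g y)"

definition constrained_viscosity_solution ::
    "(real^'n) set \<Rightarrow> (real^'n \<Rightarrow> real^'n \<Rightarrow> real) \<Rightarrow> (real^'n \<Rightarrow> real) \<Rightarrow> bool" where
  "constrained_viscosity_solution \<Omega> H u \<longleftrightarrow>
     continuous_on (closure \<Omega>) u \<and>
     (\<forall>\<phi> x0. Ck_on 1 \<Omega> \<phi> \<and> local_max_rel \<Omega> (\<lambda>x. u x - \<phi> x) x0 \<longrightarrow>
        u x0 + H x0 (grad \<phi> x0) \<le> 0) \<and>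
     (\<forall>\<phi> G x0. C1_closure \<Omega> \<phi> G \<and> local_min_rel (closure \<Omega>) (\<lambda>x. u x - \<phi> x) x0 \<longrightarrow>
        u x0 + H x0 (G x0) \<ge> 0)"

definition loewner_le :: "real^'n^'n \<Rightarrow> real^'n^'n \<Rightarrow> bool" where
  "loewner_le A B \<longleftrightarrow> (\<forall>v. v \<bullet> (A *v v) \<le> v \<bullet> (B *v v))"

text \<open>The inequality \<open>- D\<^sup>2 u \<ge> - C I\<close> in the viscosity sense.\<close>

definition viscosity_neg_hessian_ge ::
    "(real^'n) set \<Rightarrow> (real^'n \<Rightarrow> real) \<Rightarrow> real \<Rightarrow> bool" where
  "viscosity_neg_hessian_ge \<Omega> u C \<longleftrightarrow>
     (\<forall>\<phi> x. smooth_on \<Omega> \<phi> \<and> local_min_rel \<Omega> (\<lambda>y. u y - \<phi> y) x \<longrightarrow>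
        loewner_le (hessian \<phi> x) (C *\<^sub>R mat 1))"

end

theory Submission
  imports Defs
begin

text \<open>
  Let \<open>m\<close> be the minimum of \<open>f\<close>. Comparison with constants and paraboloids gives \<open>m \<le> u \<le> f\<close>, so \<open>u = f = m\<close>
  on the boundary, and the extensions by zero \<open>F\<close>, \<open>U\<close> of \<open>f - m\<close>, \<open>u - m\<close> are continuous on the whole
  space. The gradient bound forces \<open>Df = 0\<close> on the boundary, so \<open>F\<close> is \<open>C\<^sup>1\<close> and globally semiconcave with
  the constant \<open>K\<close> of \<open>f\<close>. Translating optimal trajectories, which becomes possible once there is no
  boundary, suggests that \<open>U\<close> is semiconcave with the same \<open>K\<close>. In viscosity terms: at a maximum
  of \<open>U x + U y - 2 * U z\<close> penalized by \<open>c\<close> times the squares of \<open>x - (z + h)\<close> and \<open>y - (z - h)\<close>, the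
  gradients at \<open>x\<close> and \<open>y\<close> have the gradient at \<open>z\<close> as their average, so the gradient terms drop out
  by convexity of \<open>\<beta> \<mapsto> |\<beta>|\<^sup>p\<close>, and only the second difference of \<open>F\<close> is left as \<open>c\<close> grows.
\<close>

section \<open>Extension by zero: differentiability and second differences\<close>

lemma abs_diff_le_of_deriv_bound:
  fixes g D :: "real \<Rightarrow> real"
  assumes "a < b" and "continuous_on {a..b} g"
    and deriv: "\<And>x. a < x \<Longrightarrow> x < b \<Longrightarrow> (g has_real_derivative D x) (at x)"
    and bound: "\<And>x. a < x \<Longrightarrow> x < b \<Longrightarrow> \<bar>D x\<bar> \<le> e"
  shows "\<bar>g b - g a\<bar> \<le> e * (b - a)"
proof -
  obtain x where x: "a < x" "x < b" "g b - g a = D x * (b - a)"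
    using mvt[OF assms(1,2), of "\<lambda>x h. D x * h"] deriv
    by (auto simp: has_field_derivative_def)
  then show ?thesis
    using bound[of x] assms(1) by (auto simp: abs_mult intro!: mult_right_mono)
qed

text \<open>At \<open>t\<close> outside \<open>S\<close> it suffices that \<open>g s\<close> is at
  most \<open>e * |s - t|\<close> in absolute value for \<open>s\<close> near \<open>t\<close>. On
  the way from \<open>s\<close> in \<open>S\<close> towards \<open>t\<close> there is a first point
  outside \<open>S\<close>. There \<open>g\<close> vanishes, and the mean value theorem applies up
  to it, with small slopes because \<open>D\<close> is continuous and
  \<open>D t = 0\<close>.\<close>

lemma has_real_derivative_zero_extension:
  fixes g D :: "real \<Rightarrow> real"
  assumes "open S" and g: "continuous_on UNIV g" and D: "continuous_on UNIV D"
    and deriv: "\<And>t. t \<in> S \<Longrightarrow> (g has_real_derivative D t) (at t)"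
    and zero: "\<And>t. t \<notin> S \<Longrightarrow> g t = 0 \<and> D t = 0"
  shows "(g has_real_derivative D t) (at t)"
proof (cases "t \<in> S")
  case False
  have bound: "\<bar>g s\<bar> \<le> e * \<bar>s - t\<bar>"
    if "e > 0" and De: "\<And>x. \<bar>x - t\<bar> \<le> \<bar>s - t\<bar> \<Longrightarrow> \<bar>D x\<bar> \<le> e" for s e
  proof (cases "s \<in> S")
    case True
    \<comment> \<open>The points between \<open>t\<close> and \<open>s\<close> outside
      \<open>S\<close>. The one nearest to \<open>s\<close> is that first exit point
      \<open>a\<close>, so everything strictly between \<open>a\<close> and \<open>s\<close> lies in
      \<open>S\<close>.\<close>
    let ?A = "cball t \<bar>s - t\<bar> \<inter> closed_segment t s - S"
    have "compact ?A"
      using \<open>open S\<close> by (intro compact_diff compact_Int) auto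
    moreover have "t \<in> ?A"
      using False by auto
    ultimately obtain a where a: "a \<in> ?A" "\<And>y. y \<in> ?A \<Longrightarrow> dist s a \<le> dist s y"
      using distance_attains_inf[of ?A s] compact_imp_closed by (metis empty_iff)
    have mem: "x \<in> S" if "x \<in> closed_segment t s" "\<bar>s - x\<bar> < \<bar>s - a\<bar>" for x
      using a(2)[of x] that by (auto simp: dist_real_def closed_segment_eq_real_ivl split: if_splits)
    have "a \<noteq> s"
      using a True by auto
    have "\<bar>g s - g a\<bar> \<le> e * \<bar>s - a\<bar>"
    proof (cases "a < s")
      case True
      have "\<bar>g s - g a\<bar> \<le> e * (s - a)"
      proof (rule abs_diff_le_of_deriv_bound[where D = D])
        fix x assume "a < x" "x < s"
        then show "(g has_real_derivative D x) (at x)"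
          using a(1) True
          by (intro deriv mem) (auto simp: closed_segment_eq_real_ivl split: if_splits)
        show "\<bar>D x\<bar> \<le> e"
          using a(1) True \<open>a < x\<close> \<open>x < s\<close>
          by (intro De) (auto simp: closed_segment_eq_real_ivl dist_real_def split: if_splits)
      qed (use True g continuous_on_subset in auto)
      then show ?thesis using True by simp
    next
      case False
      with \<open>a \<noteq> s\<close> have "s < a" by simp
      have "\<bar>g a - g s\<bar> \<le> e * (a - s)"
      proof (rule abs_diff_le_of_deriv_bound[where D = D])
        fix x assume "s < x" "x < a"
        then show "(g has_real_derivative D x) (at x)"
          using a(1) \<open>s < a\<close>
          by (intro deriv mem) (auto simp: closed_segment_eq_real_ivl split: if_splits)
        show "\<bar>D x\<bar> \<le> e"
          using a(1) \<open>s < a\<close> \<open>s < x\<close> \<open>x < a\<close>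
          by (intro De) (auto simp: closed_segment_eq_real_ivl dist_real_def split: if_splits)
      qed (use \<open>s < a\<close> g continuous_on_subset in auto)
      then show ?thesis using \<open>s < a\<close> by simp
    qed
    moreover have "g a = 0"
      using a(1) zero by auto
    moreover have "\<bar>s - a\<bar> \<le> \<bar>s - t\<bar>"
      using a(1) by (auto simp: closed_segment_eq_real_ivl split: if_splits)
    ultimately show ?thesis
      using \<open>e > 0\<close> by (smt (verit) mult_left_mono)
  qed (use zero that in auto)
  have "(g has_derivative (*) (D t)) (at t)"
    unfolding has_derivative_at_alt
  proof (intro conjI allI impI)
    show "bounded_linear ((*) (D t))"
      by (rule bounded_linear_mult_right)
    fix e :: real assume "e > 0"
    have "isCont D t"
      using D by (simp add: continuous_on_eq_continuous_at)
    then obtain d where d: "d > 0" "\<And>x. \<bar>x - t\<bar> < d \<Longrightarrow> \<bar>D x - D t\<bar> < e"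
      using \<open>e > 0\<close> unfolding continuous_at_eps_delta by (auto simp: dist_real_def)
    show "\<exists>d>0. \<forall>y. norm (y - t) < d \<longrightarrow> norm (g y - g t - D t * (y - t)) \<le> e * norm (y - t)"
    proof (intro exI conjI allI impI)
      fix y assume "norm (y - t) < d"
      then have "\<bar>g y\<bar> \<le> e * \<bar>y - t\<bar>"
        using d(2) zero[OF False] \<open>e > 0\<close> by (intro bound) (auto simp: less_imp_le)
      then show "norm (g y - g t - D t * (y - t)) \<le> e * norm (y - t)"
        using zero[OF False] by simp
    qed (rule d(1))
  qed
  then show ?thesis
    by (simp add: has_field_derivative_def)
qed (rule deriv)

text \<open>Second differences telescope: on an equidistant grid the last difference quotient
  exceeds the first by at most \<open>K * (t - s) - K * r\<close>. Refining the grid turns the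
  quotients into \<open>D t\<close> and \<open>D s\<close>.\<close>

lemma second_difference_bound_imp_deriv_diff_le:
  fixes g D :: "real \<Rightarrow> real"
  assumes "s < t"
    and s: "(g has_real_derivative D s) (at s)" and t: "(g has_real_derivative D t) (at t)"
    and sc: "\<And>x r. 0 < r \<Longrightarrow> s \<le> x - r \<Longrightarrow> x + r \<le> t \<Longrightarrow> g (x + r) + g (x - r) - 2 * g x \<le> K * r\<^sup>2"
  shows "D t - D s \<le> K * (t - s)"
proof -
  have tele: "(g (s + real (Suc n) * r) - g (s + real n * r)) - (g (s + r) - g s) \<le> real n * (K * r\<^sup>2)"
    if "r > 0" "s + real (Suc n) * r \<le> t" for n r
    using that
  proof (induction n)
    case (Suc n)
    have "s + real (Suc n) * r \<le> t"
      using Suc.prems by (simp add: algebra_simps)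
    then have 1: "(g (s + real (Suc n) * r) - g (s + real n * r)) - (g (s + r) - g s) \<le> real n * (K * r\<^sup>2)"
      using Suc by blast
    have "s \<le> s + real (Suc n) * r - r"
      using Suc.prems by (simp add: algebra_simps)
    moreover have "s + real (Suc n) * r + r \<le> t"
      using Suc.prems by (simp add: algebra_simps)
    ultimately have "g (s + real (Suc n) * r + r) + g (s + real (Suc n) * r - r)
        - 2 * g (s + real (Suc n) * r) \<le> K * r\<^sup>2"
      using Suc.prems sc by blast
    moreover have "s + real (Suc n) * r + r = s + real (Suc (Suc n)) * r"
      "s + real (Suc n) * r - r = s + real n * r"
      by (simp_all add: algebra_simps)
    ultimately have 2: "g (s + real (Suc (Suc n)) * r) + g (s + real n * r)
        - 2 * g (s + real (Suc n) * r) \<le> K * r\<^sup>2"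
      by (simp only:)
    have "real (Suc n) * (K * r\<^sup>2) = real n * (K * r\<^sup>2) + K * r\<^sup>2"
      by (simp add: algebra_simps)
    with 1 2 show ?case by linarith
  qed simp
  \<comment> \<open>With this step length the grid of \<open>n + 1\<close> steps ends exactly at
    \<open>t\<close>. It has only \<open>n\<close> inner points, which produces the correction
    \<open>K * r n\<close> in \<open>le\<close>; it vanishes in the limit.\<close>
  define r where "r n = (t - s) * inverse (real (Suc n))" for n
  have r: "r n > 0" "real (Suc n) * r n = t - s" for n
    using \<open>s < t\<close> by (auto simp: r_def)
  have r0: "r \<longlonglongrightarrow> 0"
    unfolding r_def using tendsto_mult[OF tendsto_const LIMSEQ_inverse_real_of_nat] by simp
  have r_at: "filterlim r (at 0) sequentially" "filterlim (\<lambda>n. - r n) (at 0) sequentially"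
    using r0 tendsto_minus[OF r0] less_imp_neq[OF r(1)]
    by (auto simp: filterlim_at intro!: always_eventually)
  have lim_s: "(\<lambda>n. (g (s + r n) - g s) / r n) \<longlonglongrightarrow> D s"
    using filterlim_compose[OF s[unfolded DERIV_def] r_at(1)] .
  have lim_t: "(\<lambda>n. (g (t + - r n) - g t) / - r n) \<longlonglongrightarrow> D t"
    using filterlim_compose[OF t[unfolded DERIV_def] r_at(2)] .
  have le: "(g (t + - r n) - g t) / - r n - (g (s + r n) - g s) / r n \<le> K * (t - s) - K * r n" for n
  proof -
    have "(g (s + real (Suc n) * r n) - g (s + real n * r n)) - (g (s + r n) - g s)
        \<le> real n * (K * (r n)\<^sup>2)"
      using r by (intro tele) auto
    moreover have "s + real (Suc n) * r n = t"
      using r(2) by simp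
    moreover have "s + real n * r n = t - r n"
      using r(2)[of n] by (simp add: algebra_simps)
    ultimately have "(g t - g (t - r n)) - (g (s + r n) - g s) \<le> real n * (K * (r n)\<^sup>2)"
      by simp
    also have "\<dots> = (K * (t - s) - K * r n) * r n"
      unfolding r(2)[of n, symmetric] by (simp add: algebra_simps power2_eq_square)
    finally have "((g t - g (t - r n)) - (g (s + r n) - g s)) / r n \<le> K * (t - s) - K * r n"
      using r(1)[of n] by (simp add: pos_divide_le_eq)
    moreover have "((g t - g (t - r n)) - (g (s + r n) - g s)) / r n
        = (g (t + - r n) - g t) / - r n - (g (s + r n) - g s) / r n"
      using r(1)[of n] by (simp add: field_simps)
    ultimately show ?thesis by simp
  qed
  have "(\<lambda>n. K * (t - s) - K * r n) \<longlonglongrightarrow> K * (t - s) - K * 0"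
    by (intro tendsto_intros r0)
  from LIMSEQ_le[OF tendsto_diff[OF lim_t lim_s] this] le show ?thesis
    by auto
qed

text \<open>The core is \<open>D_le\<close>, a one-sided Lipschitz bound for \<open>D\<close> on the
  whole line. Inside \<open>S\<close> it comes from second differences; an interval that leaves
  \<open>S\<close> is cut at its first and last points outside \<open>S\<close>. \<open>D\<close>
  vanishes at both, so the middle piece contributes nothing, which is at most \<open>K\<close> times
  its length.\<close>

lemma zero_extension_second_difference_le:
  fixes g D :: "real \<Rightarrow> real"
  assumes "open S" and g: "continuous_on UNIV g" and D: "continuous_on UNIV D"
    and deriv: "\<And>t. t \<in> S \<Longrightarrow> (g has_real_derivative D t) (at t)"
    and zero: "\<And>t. t \<notin> S \<Longrightarrow> g t = 0 \<and> D t = 0"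
    and "K \<ge> 0"
    and sc: "\<And>x r. 0 < r \<Longrightarrow> {x - r..x + r} \<subseteq> S \<Longrightarrow> g (x + r) + g (x - r) - 2 * g x \<le> K * r\<^sup>2"
  shows "g 1 + g (- 1) - 2 * g 0 \<le> K"
proof -
  have deriv': "(g has_real_derivative D t) (at t)" for t
    using has_real_derivative_zero_extension[OF assms(1) g D] deriv zero by blast
  have interior: "D t - D s \<le> K * (t - s)" if "s < t" "{s<..<t} \<subseteq> S" for s t
  proof -
    \<comment> \<open>The endpoints may lie outside \<open>S\<close>, where \<open>sc\<close> says
      nothing. The interval is therefore shrunk by \<open>e\<close> on both sides, and
      \<open>e\<close> tends to \<open>0\<close> by continuity of \<open>D\<close>.\<close>
    let ?F = "\<lambda>e. D (t - e) - D (s + e) - K * ((t - e) - (s + e))"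
    have "?F e \<le> 0" if e: "e \<in> {0<..<(t - s) / 2}" for e
    proof -
      have "D (t - e) - D (s + e) \<le> K * ((t - e) - (s + e))"
      proof (rule second_difference_bound_imp_deriv_diff_le[OF _ deriv' deriv'])
        show "s + e < t - e" using e by (simp add: field_simps)
        fix x r assume "0 < r" "s + e \<le> x - r" "x + r \<le> t - e"
        then show "g (x + r) + g (x - r) - 2 * g x \<le> K * r\<^sup>2"
          using e \<open>{s<..<t} \<subseteq> S\<close> by (intro sc) auto
      qed
      then show ?thesis by simp
    qed
    moreover have "continuous_on (closure {0<..<(t - s) / 2}) ?F"
      by (intro continuous_intros continuous_on_compose2[OF D]) auto
    moreover have "0 \<in> closure {0<..<(t - s) / 2}"
      using \<open>s < t\<close> by (subst closure_greaterThanLessThan) auto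
    ultimately have "?F 0 \<le> 0"
      using continuous_le_on_closure[of "{0<..<(t - s) / 2}" ?F 0 0] by blast
    then show ?thesis by simp
  qed
  have D_le: "D t - D s \<le> K * (t - s)" if "s \<le> t" for s t
  proof (cases "{s..t} \<subseteq> S")
    case True
    then show ?thesis
      using interior[of s t] that by (cases "s = t") (auto simp: subset_iff)
  next
    case False
    let ?A = "{s..t} - S"
    have A: "compact ?A" "?A \<noteq> {}"
      using \<open>open S\<close> False by (auto intro: compact_diff)
    obtain a where a: "a \<in> ?A" "\<And>y. y \<in> ?A \<Longrightarrow> a \<le> y"
      using compact_attains_inf[OF A] by auto
    obtain b where b: "b \<in> ?A" "\<And>y. y \<in> ?A \<Longrightarrow> y \<le> b"
      using compact_attains_sup[OF A] by auto
    have "x \<in> S" if "x \<in> {s<..<a}" for x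
      using a(1) a(2)[of x] that by force
    then have "{s<..<a} \<subseteq> S"
      by blast
    then have 1: "D a - D s \<le> K * (a - s)"
      using interior[of s a] a(1) by (cases "s = a") auto
    have "x \<in> S" if "x \<in> {b<..<t}" for x
      using b(1) b(2)[of x] that by force
    then have "{b<..<t} \<subseteq> S"
      by blast
    then have 2: "D t - D b \<le> K * (t - b)"
      using interior[of b t] b(1) by (cases "t = b") auto
    have "K * a \<le> K * b"
      using a(2)[OF b(1)] \<open>K \<ge> 0\<close> by (rule mult_left_mono)
    then show ?thesis
      using 1 2 zero a(1) b(1) by (auto simp: algebra_simps)
  qed
  \<comment> \<open>The derivative \<open>D x - D (- x) - 2 * K * x\<close> is nonpositive on the
    unit interval by \<open>D_le\<close>, and comparing the values at \<open>1\<close> and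
    \<open>0\<close> is the claim.\<close>
  let ?\<phi> = "\<lambda>x. g x + g (- x) - K * x\<^sup>2"
  have "?\<phi> 1 \<le> ?\<phi> 0"
  proof (rule DERIV_nonpos_imp_nonincreasing[where f = ?\<phi>])
    fix x :: real assume x: "0 \<le> x" "x \<le> 1"
    have "((\<lambda>x. g (- x)) has_real_derivative D (- x) * - 1) (at x)"
      by (rule DERIV_chain2[where g = uminus]) (auto intro!: deriv' derivative_eq_intros)
    then have "(?\<phi> has_real_derivative D x + D (- x) * - 1 - K * (2 * x)) (at x)"
      by (intro DERIV_diff DERIV_add deriv') (auto intro!: derivative_eq_intros)
    then have "(?\<phi> has_real_derivative D x - D (- x) - K * (2 * x)) (at x)"
      by simp
    moreover have "D x - D (- x) - K * (2 * x) \<le> 0"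
      using D_le[of "- x" x] x by (simp add: algebra_simps)
    ultimately show "\<exists>y. (?\<phi> has_real_derivative y) (at x) \<and> y \<le> 0"
      by blast
  qed simp
  then show ?thesis by simp
qed

text \<open>Restriction to the line through \<open>z\<close> in direction \<open>h\<close> reduces
  this to one dimension with constant \<open>K * (norm h)\<^sup>2\<close>. The line may enter and
  leave the set repeatedly, which is why the one-dimensional lemma allows any open
  \<open>S\<close>.\<close>

lemma zero_extension_semiconcave:
  fixes F :: "'a::real_inner \<Rightarrow> real" and G :: "'a \<Rightarrow> 'a"
  assumes "open \<Omega>" and F: "continuous_on UNIV F" and G: "continuous_on UNIV G"
    and deriv: "\<And>x. x \<in> \<Omega> \<Longrightarrow> GDERIV F x :> G x"
    and zero: "\<And>x. x \<notin> \<Omega> \<Longrightarrow> F x = 0 \<and> G x = 0"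
    and "K \<ge> 0"
    and sc: "\<And>x h. closed_segment (x - h) (x + h) \<subseteq> \<Omega> \<Longrightarrow>
        F (x + h) + F (x - h) - 2 * F x \<le> K * (norm h)\<^sup>2"
  shows "F (z + h) + F (z - h) - 2 * F z \<le> K * (norm h)\<^sup>2"
proof -
  let ?l = "\<lambda>t::real. z + t *\<^sub>R h"
  let ?S = "?l -` \<Omega>"
  have cont: "continuous_on A ?l" for A
    by (intro continuous_intros)
  have "F (?l 1) + F (?l (- 1)) - 2 * F (?l 0) \<le> K * (norm h)\<^sup>2"
  proof (rule zero_extension_second_difference_le[where S = ?S and D = "\<lambda>t. h \<bullet> G (?l t)"])
    show "open ?S"
      using \<open>open \<Omega>\<close> by (intro open_vimage cont)
    show "continuous_on UNIV (\<lambda>t. F (?l t))" "continuous_on UNIV (\<lambda>t. h \<bullet> G (?l t))"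
      using continuous_on_compose2[OF F cont] continuous_on_compose2[OF G cont]
      by (auto intro!: continuous_intros)
    show "((\<lambda>t. F (?l t)) has_real_derivative h \<bullet> G (?l t)) (at t)" if "t \<in> ?S" for t
    proof -
      have "(F has_derivative (\<lambda>v. v \<bullet> G (?l t))) (at (?l t))"
        using deriv that by (simp add: gderiv_def)
      moreover have "(?l has_derivative (\<lambda>s. s *\<^sub>R h)) (at t)"
        by (auto intro!: derivative_eq_intros)
      ultimately have "((\<lambda>t. F (?l t)) has_derivative (\<lambda>s. (s *\<^sub>R h) \<bullet> G (?l t))) (at t)"
        using has_derivative_compose by blast
      then show ?thesis
        by (simp add: has_field_derivative_def mult_commute_abs)
    qed
    show "F (?l (x + r)) + F (?l (x - r)) - 2 * F (?l x) \<le> K * (norm h)\<^sup>2 * r\<^sup>2"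
      if "0 < r" and sub: "{x - r..x + r} \<subseteq> ?S" for x r
    proof -
      have "closed_segment (?l x - r *\<^sub>R h) (?l x + r *\<^sub>R h) \<subseteq> \<Omega>"
      proof
        fix y assume "y \<in> closed_segment (?l x - r *\<^sub>R h) (?l x + r *\<^sub>R h)"
        then obtain c where c: "0 \<le> c" "c \<le> 1"
          "y = (1 - c) *\<^sub>R (?l x - r *\<^sub>R h) + c *\<^sub>R (?l x + r *\<^sub>R h)"
          by (auto simp: closed_segment_def)
        have "(2 * c) *\<^sub>R v = c *\<^sub>R v + c *\<^sub>R v" for v :: 'a
          by (metis mult_2 scaleR_left.add)
        then have comb: "(1 - c) *\<^sub>R (w - v) + c *\<^sub>R (w + v) = w + (2 * c - 1) *\<^sub>R v" for w v :: 'a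
          by (simp add: scaleR_left_diff_distrib scaleR_right_diff_distrib scaleR_right_distrib)
        have "y = ?l x + (2 * c - 1) *\<^sub>R (r *\<^sub>R h)"
          unfolding c(3) by (rule comb)
        then have "y = ?l (x + (2 * c - 1) * r)"
          by (simp add: scaleR_left_distrib)
        moreover have "x + (2 * c - 1) * r = x - r + 2 * c * r"
          by (simp add: algebra_simps)
        moreover have "0 \<le> c * r" "c * r \<le> r"
          using c \<open>0 < r\<close> by (auto simp: mult_left_le_one_le)
        then have "x - r + 2 * c * r \<in> {x - r..x + r}"
          by (simp add: mult.assoc)
        then have "x - r + 2 * c * r \<in> ?S"
          using sub by blast
        ultimately show "y \<in> \<Omega>" by simp
      qed
      from sc[OF this] show ?thesis
        by (simp add: algebra_simps power_mult_distrib)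
    qed
  qed (use zero \<open>K \<ge> 0\<close> in auto)
  then show ?thesis by simp
qed

section \<open>Semiconcavity for convex Hamiltonians on the whole space\<close>

lemma powr_midpoint_convex:
  fixes a b p :: real
  assumes "a \<ge> 0" "b \<ge> 0" "p \<ge> 1"
  shows "((a + b) / 2) powr p \<le> (a powr p + b powr p) / 2"
proof -
  have half: "(c / 2) powr p \<le> c powr p / 2" if "c \<ge> 0" for c :: real
  proof -
    have "2 powr 1 \<le> (2::real) powr p"
      using assms by (intro powr_mono) auto
    then show ?thesis
      using that frac_le[of "c powr p" "c powr p" 2 "2 powr p"] by (simp add: powr_divide)
  qed
  show ?thesis
  proof (cases "a = 0 \<or> b = 0")
    case True
    then show ?thesis
      using half[of a] half[of b] assms by auto
  next
    case False
    then have "((1 - 1/2) *\<^sub>R a + (1/2) *\<^sub>R b) powr p \<le> (1 - 1/2) * a powr p + (1/2) * b powr p"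
      using assms by (intro convex_onD[OF powr_convex]) auto
    then show ?thesis
      by (simp add: field_simps)
  qed
qed

lemma norm_powr_midpoint_convex:
  fixes P Q :: "'a::real_normed_vector"
  assumes "p \<ge> 1"
  shows "norm ((P + Q) /\<^sub>R 2) powr p \<le> (norm P powr p + norm Q powr p) / 2"
proof -
  have "norm ((P + Q) /\<^sub>R 2) powr p \<le> ((norm P + norm Q) / 2) powr p"
    using assms norm_triangle_ineq[of P Q] by (intro powr_mono2) auto
  also have "\<dots> \<le> (norm P powr p + norm Q powr p) / 2"
    using assms by (intro powr_midpoint_convex) auto
  finally show ?thesis .
qed

text \<open>Two paraboloids with different centres add up to one paraboloid around the midpoint plus
  a constant. This turns the two penalties, seen as functions of \<open>z\<close>, into a single
  test function.\<close>

lemma norm_diff_midpoint: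
  fixes z a b :: "'a::real_inner"
  shows "(norm (z - a))\<^sup>2 + (norm (z - b))\<^sup>2 =
    2 * (norm (z - (a + b) /\<^sub>R 2))\<^sup>2 + (norm (a - b))\<^sup>2 / 2"
  by (simp add: power2_norm_eq_inner inner_diff_left inner_diff_right inner_add_left
      inner_add_right inner_commute algebra_simps) (simp add: field_simps)

text \<open>The viscosity inequalities enter only through \<open>sub\<close> and
  \<open>super\<close>, for paraboloids touching globally, since the penalized function is quadratic
  in each variable up to \<open>U\<close>. A fixed large \<open>c\<close>, depending on the excess
  \<open>\<delta>\<close> over the bound, suffices for a contradiction.\<close>

lemma semiconcave_of_convex_Hamilton_Jacobi:
  fixes U F :: "'a::euclidean_space \<Rightarrow> real"
  assumes "bounded \<Omega>" and "p \<ge> 1" and "K \<ge> 0"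
    and U: "continuous_on UNIV U" and F: "continuous_on UNIV F"
    and U_nonneg: "\<And>x. U x \<ge> 0"
    and zero: "\<And>x. x \<notin> \<Omega> \<Longrightarrow> U x = 0 \<and> F x = 0"
    and F_sc: "\<And>x h. F (x + h) + F (x - h) - 2 * F x \<le> K * (norm h)\<^sup>2"
    and sub: "\<And>x a c. c > 0 \<Longrightarrow> (\<And>y. U y - c * (norm (y - a))\<^sup>2 \<le> U x - c * (norm (x - a))\<^sup>2) \<Longrightarrow>
        U x + norm ((2 * c) *\<^sub>R (x - a)) powr p \<le> F x"
    and super: "\<And>x a c. c > 0 \<Longrightarrow> (\<And>y. U x + c * (norm (x - a))\<^sup>2 \<le> U y + c * (norm (y - a))\<^sup>2) \<Longrightarrow>
        F x \<le> U x + norm ((2 * c) *\<^sub>R (a - x)) powr p"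
  shows "U (x0 + h) + U (x0 - h) - 2 * U x0 \<le> K * (norm h)\<^sup>2"
proof (rule ccontr)
  assume contra: "\<not> ?thesis"
  define \<delta> where "\<delta> = U (x0 + h) + U (x0 - h) - 2 * U x0 - K * (norm h)\<^sup>2"
  have "\<delta> > 0"
    using contra by (simp add: \<delta>_def)
  obtain R where R: "\<And>x. x \<in> \<Omega> \<Longrightarrow> norm x \<le> R"
    using \<open>bounded \<Omega>\<close> by (auto simp: bounded_iff)
  have "compact (U ` cball 0 R)"
    using U continuous_on_subset by (intro compact_continuous_image) auto
  then have "bounded (U ` cball 0 R)"
    by (rule compact_imp_bounded)
  then obtain M' where M': "\<And>x. x \<in> cball 0 R \<Longrightarrow> \<bar>U x\<bar> \<le> M'"
    unfolding bounded_iff by fastforce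
  define M where "M = max M' 1"
  have "M > 0"
    by (simp add: M_def)
  have M: "U x \<le> M" for x
    using M'[of x] R[of x] zero[of x] \<open>M > 0\<close> by (cases "x \<in> \<Omega>") (auto simp: M_def)
  \<comment> \<open>The extra \<open>1\<close> gives room for points at distance below
    \<open>\<eta> <= 1\<close> from \<open>\<Omega>\<close>; if both points lie outside
    \<open>\<Omega>\<close>, then \<open>F\<close> is \<open>0\<close> at both. The tolerance
    \<open>\<delta> / 2\<close> is spent twice, at \<open>x\<close> and at \<open>y\<close>.\<close>
  have "uniformly_continuous_on (cball 0 (R + 1)) F"
    using F continuous_on_subset by (intro compact_uniformly_continuous) auto
  then obtain d where d: "d > 0" "\<And>x y. x \<in> cball 0 (R + 1) \<Longrightarrow> y \<in> cball 0 (R + 1) \<Longrightarrow>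
      dist y x < d \<Longrightarrow> \<bar>F y - F x\<bar> < \<delta> / 2"
    using \<open>\<delta> > 0\<close> unfolding uniformly_continuous_on_def dist_real_def by (metis half_gt_zero)
  define \<eta> where "\<eta> = min d 1"
  have "\<eta> > 0" "\<eta> \<le> 1"
    using d by (auto simp: \<eta>_def)
  have F_uc: "\<bar>F x - F y\<bar> < \<delta> / 2" if "norm (x - y) < \<eta>" for x y
  proof (cases "x \<in> \<Omega> \<or> y \<in> \<Omega>")
    case True
    then have "norm x \<le> R + 1 \<and> norm y \<le> R + 1"
      using R[of x] R[of y] that \<open>\<eta> \<le> 1\<close> norm_triangle_ineq3[of x y] by auto
    then show ?thesis
      using d(2)[of y x] that by (auto simp: \<eta>_def dist_norm)
  qed (use zero \<open>\<delta> > 0\<close> in auto)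
  \<comment> \<open>Where \<open>\<Phi>\<close> is positive, each penalty is at most
    \<open>2 * M\<close>. This \<open>c\<close> makes \<open>c * \<eta>\<^sup>2\<close> larger than
    \<open>2 * M\<close>, which forces the penalized distances below \<open>\<eta>\<close>.\<close>
  define c where "c = 2 * M / \<eta>\<^sup>2 + 1"
  have "c > 0"
    using \<open>M > 0\<close> by (simp add: c_def add_nonneg_pos)
  have small: "norm v < \<eta>" if "c * (norm v)\<^sup>2 \<le> 2 * M" for v :: 'a
  proof (rule ccontr)
    assume "\<not> norm v < \<eta>"
    then have "\<eta>\<^sup>2 \<le> (norm v)\<^sup>2"
      using \<open>\<eta> > 0\<close> by (intro power_mono) auto
    then have "c * \<eta>\<^sup>2 \<le> 2 * M"
      using that \<open>c > 0\<close> by (smt (verit) mult_left_mono)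
    moreover have "c * \<eta>\<^sup>2 = 2 * M + \<eta>\<^sup>2"
      using \<open>\<eta> > 0\<close> by (simp add: c_def field_simps)
    ultimately show False
      using \<open>\<eta> > 0\<close> by simp
  qed
  define \<Phi> where "\<Phi> = (\<lambda>(x, y, z). U x + U y - 2 * U z
      - c * (norm (x - (z + h)))\<^sup>2 - c * (norm (y - (z - h)))\<^sup>2)"
  have near: "norm (x - (z + h)) < \<eta> \<and> norm (y - (z - h)) < \<eta>" if "\<Phi> (x, y, z) > 0" for x y z
  proof -
    have "c * (norm (x - (z + h)))\<^sup>2 \<ge> 0" "c * (norm (y - (z - h)))\<^sup>2 \<ge> 0"
      using \<open>c > 0\<close> by auto
    then show ?thesis
      using that M[of x] M[of y] U_nonneg[of z] by (intro conjI small) (simp_all add: \<Phi>_def)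
  qed
  \<comment> \<open>If \<open>\<Phi>\<close> is positive, then \<open>x\<close> or \<open>y\<close>
    lies in \<open>\<Omega>\<close>, hence in the ball of radius \<open>R\<close>. Passing to
    \<open>z\<close> and then to the remaining point costs at most \<open>1 + norm h\<close> each
    time. So the maximum over \<open>B\<close> is global.\<close>
  define r where "r = R + 2 + 2 * norm h"
  define B where "B = cball (0::'a) r \<times> cball (0::'a) r \<times> cball (0::'a) r"
  have inside: "(x, y, z) \<in> B" if pos: "\<Phi> (x, y, z) > 0" for x y z
  proof -
    have "x \<in> \<Omega> \<or> y \<in> \<Omega>"
    proof (rule ccontr)
      assume "\<not> ?thesis"
      moreover have "c * (norm (x - (z + h)))\<^sup>2 \<ge> 0" "c * (norm (y - (z - h)))\<^sup>2 \<ge> 0"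
        using \<open>c > 0\<close> by auto
      ultimately show False
        using pos zero[of x] zero[of y] U_nonneg[of z] by (simp add: \<Phi>_def)
    qed
    then have "norm x \<le> R \<or> norm y \<le> R"
      using R by blast
    moreover have "norm (x - z - h) \<le> 1" "norm (y - z + h) \<le> 1"
      using near[OF pos] \<open>\<eta> \<le> 1\<close> by (simp_all add: algebra_simps)
    moreover have "norm x \<le> norm (x - z - h) + norm z + norm h"
      "norm y \<le> norm (y - z + h) + norm z + norm h"
      "norm z \<le> norm (x - z - h) + norm x + norm h" "norm z \<le> norm (y - z + h) + norm y + norm h"
      by norm+
    ultimately have "norm x \<le> r \<and> norm y \<le> r \<and> norm z \<le> r"
      using norm_ge_zero[of h] unfolding r_def by linarith
    then show ?thesis
      by (simp add: B_def)
  qed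
  have start: "\<Phi> (x0 + h, x0 - h, x0) = \<delta> + K * (norm h)\<^sup>2"
    by (simp add: \<Phi>_def \<delta>_def)
  have start_pos: "\<Phi> (x0 + h, x0 - h, x0) > 0"
    unfolding start using \<open>\<delta> > 0\<close> \<open>K \<ge> 0\<close> by (simp add: add_pos_nonneg)
  have "compact B"
    unfolding B_def by (intro compact_Times) auto
  moreover have "B \<noteq> {}"
    using inside[OF start_pos] by blast
  moreover have "continuous_on B \<Phi>"
    unfolding \<Phi>_def case_prod_beta
    by (intro continuous_intros continuous_on_compose2[OF U]) auto
  ultimately obtain m where m: "m \<in> B" "\<And>w. w \<in> B \<Longrightarrow> \<Phi> w \<le> \<Phi> m"
    using continuous_attains_sup by metis
  obtain x y z where xyz: "m = (x, y, z)"
    by (cases m)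
  have max_ge: "\<Phi> m \<ge> \<delta> + K * (norm h)\<^sup>2"
    using m(2)[OF inside[OF start_pos]] by (simp add: start)
  have max_pos: "\<Phi> (x, y, z) > 0"
    using m(2)[OF inside[OF start_pos]] start_pos by (simp add: xyz)
  have max: "\<Phi> (x', y', z') \<le> \<Phi> (x, y, z)" for x' y' z'
  proof (cases "\<Phi> (x', y', z') > 0")
    case True
    then show ?thesis
      using m(2) inside xyz by metis
  qed (use max_pos in linarith)
  \<comment> \<open>\<open>P\<close> and \<open>Q\<close> are the gradients of the two penalties in
    \<open>x\<close> and \<open>y\<close>; as test gradients at the maximum they give
    \<open>1\<close> and \<open>2\<close>.\<close>
  define P where "P = (2 * c) *\<^sub>R (x - (z + h))"
  define Q where "Q = (2 * c) *\<^sub>R (y - (z - h))"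
  have 1: "U x + norm P powr p \<le> F x"
    unfolding P_def
  proof (rule sub[OF \<open>c > 0\<close>])
    show "U x' - c * (norm (x' - (z + h)))\<^sup>2 \<le> U x - c * (norm (x - (z + h)))\<^sup>2" for x'
      using max[of x' y z] by (simp add: \<Phi>_def)
  qed
  have 2: "U y + norm Q powr p \<le> F y"
    unfolding Q_def
  proof (rule sub[OF \<open>c > 0\<close>])
    show "U y' - c * (norm (y' - (z - h)))\<^sup>2 \<le> U y - c * (norm (y - (z - h)))\<^sup>2" for y'
      using max[of x y' z] by (simp add: \<Phi>_def)
  qed
  have "F z \<le> U z + norm ((2 * c) *\<^sub>R ((x + y) /\<^sub>R 2 - z)) powr p"
  proof (rule super[OF \<open>c > 0\<close>])
    fix z'
    \<comment> \<open>As functions of \<open>v\<close> the penalties are centred at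
      \<open>x - h\<close> and \<open>y + h\<close>; the shifts cancel in the midpoint. Halving the
      maximality in \<open>z\<close> then leaves a minimum of \<open>U\<close> plus \<open>c\<close>
      times one squared distance.\<close>
    have pen: "(norm (x - (v + h)))\<^sup>2 + (norm (y - (v - h)))\<^sup>2
        = 2 * (norm (v - (x + y) /\<^sub>R 2))\<^sup>2 + (norm (x - h - (y + h)))\<^sup>2 / 2" for v
    proof -
      have "norm (x - (v + h)) = norm (v - (x - h))" "norm (y - (v - h)) = norm (v - (y + h))"
        by (subst norm_minus_commute, simp add: algebra_simps)+
      then show ?thesis
        using norm_diff_midpoint[of v "x - h" "y + h"] by simp
    qed
    have "c * ((norm (x - (v + h)))\<^sup>2 + (norm (y - (v - h)))\<^sup>2)
        = c * (2 * (norm (v - (x + y) /\<^sub>R 2))\<^sup>2 + (norm (x - h - (y + h)))\<^sup>2 / 2)" for v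
      by (simp only: pen)
    from this[of z] this[of z']
    show "U z + c * (norm (z - (x + y) /\<^sub>R 2))\<^sup>2 \<le> U z' + c * (norm (z' - (x + y) /\<^sub>R 2))\<^sup>2"
      using max[of x y z'] by (simp add: \<Phi>_def distrib_left)
  qed
  moreover have "(2 * c) *\<^sub>R ((x + y) /\<^sub>R 2 - z) = (P + Q) /\<^sub>R 2"
    by (simp add: P_def Q_def algebra_simps flip: scaleR_2)
  ultimately have 3: "F z \<le> U z + norm ((P + Q) /\<^sub>R 2) powr p"
    by (simp only:)
  have "\<Phi> m \<le> U x + U y - 2 * U z"
    using mult_nonneg_nonneg[OF less_imp_le[OF \<open>c > 0\<close>] zero_le_power2[of "norm (x - (z + h))"]]
      mult_nonneg_nonneg[OF less_imp_le[OF \<open>c > 0\<close>] zero_le_power2[of "norm (y - (z - h))"]]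
    by (simp add: xyz \<Phi>_def)
  \<comment> \<open>Twice the gradient term at \<open>z\<close> is at most the sum of those at
    \<open>x\<close> and \<open>y\<close>, by midpoint convexity, so they drop out of the
    combination.\<close>
  also have "\<dots> \<le> F x + F y - 2 * F z"
  proof -
    have "U x + U y - 2 * U z \<le> F x + F y - 2 * F z"
      if "U x + a \<le> F x" "U y + b \<le> F y" "F z \<le> U z + n" "n \<le> (a + b) / 2" for a b n
      using that by simp
    from this[OF 1 2 3 norm_powr_midpoint_convex[OF \<open>p \<ge> 1\<close>]] show ?thesis .
  qed
  also have "\<dots> < F (z + h) + F (z - h) - 2 * F z + \<delta>"
  proof -
    have "\<bar>F x - F (z + h)\<bar> < \<delta> / 2" "\<bar>F y - F (z - h)\<bar> < \<delta> / 2"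
      using F_uc near[OF max_pos] by blast+
    then show ?thesis by linarith
  qed
  also have "\<dots> \<le> \<delta> + K * (norm h)\<^sup>2"
    using F_sc[of z h] by simp
  finally show False
    using max_ge by simp
qed

section \<open>Paraboloids as test functions\<close>

lemma gderiv_quadratic:
  fixes a :: "'a::real_inner"
  shows "GDERIV (\<lambda>y. c * (norm (y - a))\<^sup>2) x :> (2 * c) *\<^sub>R (x - a)"
  unfolding gderiv_def power2_norm_eq_inner
  by (auto intro!: derivative_eq_intros simp: inner_commute algebra_simps)

lemma Ck_on_1_quadratic: "Ck_on 1 S (\<lambda>y. c * (norm (y - a))\<^sup>2)"
proof -
  have "grad (\<lambda>y. c * (norm (y - a))\<^sup>2) x = (2 * c) *\<^sub>R (x - a)" for x
    by (rule grad_eq[OF gderiv_quadratic])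
  moreover have "(\<lambda>y. c * (norm (y - a))\<^sup>2) differentiable at x" for x
    using gderiv_quadratic[of c a x] unfolding gderiv_def by (rule differentiableI)
  ultimately show ?thesis
    by (auto intro!: continuous_intros)
qed

lemma C1_closure_quadratic:
  "C1_closure S (\<lambda>y. c * (norm (y - a))\<^sup>2) (\<lambda>x. (2 * c) *\<^sub>R (x - a))"
  unfolding C1_closure_def by (auto intro!: continuous_intros gderiv_quadratic)

lemma viscosity_subsolution_quadratic:
  assumes "constrained_viscosity_solution \<Omega> H u" and "open \<Omega>" and "x \<in> \<Omega>"
    and "eventually (\<lambda>y. u y - c * (norm (y - a))\<^sup>2 \<le> u x - c * (norm (x - a))\<^sup>2) (nhds x)"
  shows "u x + H x ((2 * c) *\<^sub>R (x - a)) \<le> 0"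
proof -
  have "local_max_rel \<Omega> (\<lambda>y. u y - c * (norm (y - a))\<^sup>2) x"
    using assms(3,4) unfolding local_max_rel_def eventually_at_filter
    by (auto elim: eventually_mono)
  then have "u x + H x (grad (\<lambda>y. c * (norm (y - a))\<^sup>2) x) \<le> 0"
    using assms(1) Ck_on_1_quadratic unfolding constrained_viscosity_solution_def by blast
  then show ?thesis
    by (simp add: grad_eq[OF gderiv_quadratic])
qed

text \<open>The sign of \<open>c\<close> is left free: \<open>c = 0\<close> tests with a constant,
  and negative coefficients give the paraboloids that touch from below in the semiconcavity
  argument.\<close>

lemma viscosity_supersolution_quadratic:
  assumes "constrained_viscosity_solution \<Omega> H u" and "x \<in> closure \<Omega>"
    and "\<And>y. y \<in> closure \<Omega> \<Longrightarrow> u x - c * (norm (x - a))\<^sup>2 \<le> u y - c * (norm (y - a))\<^sup>2"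
  shows "u x + H x ((2 * c) *\<^sub>R (x - a)) \<ge> 0"
proof -
  have "local_min_rel (closure \<Omega>) (\<lambda>y. u y - c * (norm (y - a))\<^sup>2) x"
    using assms(2,3) unfolding local_min_rel_def eventually_at_filter by auto
  then show ?thesis
    using assms(1) C1_closure_quadratic[of \<Omega> c a] unfolding constrained_viscosity_solution_def
    by blast
qed

text \<open>The function \<open>u\<close> need not be touched from above at \<open>x\<close> itself.
  If \<open>u > f\<close> near \<open>x\<close>, subtracting a steep paraboloid centred at
  \<open>x\<close> creates an interior maximum nearby. The steepness does no harm because the lower
  bound on \<open>H\<close> is uniform in the gradient.\<close>

lemma viscosity_subsolution_pointwise:
  fixes u f :: "real^'n \<Rightarrow> real"
  assumes u: "constrained_viscosity_solution \<Omega> H u" and "open \<Omega>" and f: "continuous_on \<Omega> f"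
    and H: "\<And>x \<beta>. x \<in> \<Omega> \<Longrightarrow> - f x \<le> H x \<beta>" and "x \<in> \<Omega>"
  shows "u x \<le> f x"
proof (rule ccontr)
  assume "\<not> u x \<le> f x"
  have "continuous_on (closure \<Omega>) u"
    using u by (simp add: constrained_viscosity_solution_def)
  then have cont: "continuous_on \<Omega> u"
    using closure_subset by (rule continuous_on_subset)
  have "open {y \<in> \<Omega>. 0 < u y - f y}"
  proof -
    have "open ((\<lambda>y. u y - f y) -` {0<..} \<inter> \<Omega>)"
      using \<open>open \<Omega>\<close> cont f
      by (intro continuous_on_open_vimage[THEN iffD1, rule_format] continuous_intros) auto
    moreover have "(\<lambda>y. u y - f y) -` {0<..} \<inter> \<Omega> = {y \<in> \<Omega>. 0 < u y - f y}"
      by auto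
    ultimately show ?thesis by simp
  qed
  moreover have "x \<in> {y \<in> \<Omega>. 0 < u y - f y}"
    using \<open>x \<in> \<Omega>\<close> \<open>\<not> u x \<le> f x\<close> by simp
  ultimately obtain r where r: "r > 0" "cball x r \<subseteq> {y \<in> \<Omega>. 0 < u y - f y}"
    using open_contains_cball by meson
  have cont_r: "continuous_on (cball x r) u"
    using cont r(2) continuous_on_subset by blast
  obtain b where b: "\<And>y. y \<in> cball x r \<Longrightarrow> u y \<le> u b"
    using continuous_attains_sup[OF compact_cball _ cont_r] r(1) by fastforce
  \<comment> \<open>On the sphere of radius \<open>r\<close> the penalty equals
    \<open>u b - u x + 1\<close>, which pushes the values there to at most \<open>u x - 1\<close>,
    below the value at the centre.\<close>
  define c where "c = (u b - u x + 1) / r\<^sup>2"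
  obtain z where z: "z \<in> cball x r"
    "\<And>y. y \<in> cball x r \<Longrightarrow> u y - c * (norm (y - x))\<^sup>2 \<le> u z - c * (norm (z - x))\<^sup>2"
    using continuous_attains_sup[of "cball x r" "\<lambda>y. u y - c * (norm (y - x))\<^sup>2"] cont_r r(1)
    by (fastforce intro!: continuous_intros)
  have "norm (z - x) \<noteq> r"
  proof
    assume "norm (z - x) = r"
    then have "c * (norm (z - x))\<^sup>2 = u b - u x + 1"
      using r(1) by (simp add: c_def)
    then show False
      using z(2)[of x] b[OF z(1)] r(1) by simp
  qed
  then have "z \<in> ball x r"
    using z(1) by (simp add: dist_norm norm_minus_commute)
  then have "eventually (\<lambda>y. y \<in> ball x r) (nhds z)"
    by (intro eventually_nhds_in_open) auto
  then have "eventually (\<lambda>y. u y - c * (norm (y - x))\<^sup>2 \<le> u z - c * (norm (z - x))\<^sup>2) (nhds z)"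
    by eventually_elim (use z(2) in auto)
  then have "u z + H z ((2 * c) *\<^sub>R (z - x)) \<le> 0"
    using r(2) z(1) by (intro viscosity_subsolution_quadratic[OF u \<open>open \<Omega>\<close>]) auto
  then show False
    using H[of z "(2 * c) *\<^sub>R (z - x)"] r(2) z(1) by fastforce
qed

section \<open>From second differences to the viscosity inequality\<close>

lemma hessian_quadratic_form_le:
  fixes \<phi> :: "real^'n \<Rightarrow> real"
  assumes "open S" and "x \<in> S" and \<phi>: "Ck_on 2 S \<phi>"
    and le: "\<forall>\<^sub>F t in at_right 0. \<phi> (x + t *\<^sub>R v) + \<phi> (x - t *\<^sub>R v) - 2 * \<phi> x \<le> K * t\<^sup>2"
  shows "v \<bullet> (hessian \<phi> x *v v) \<le> K"
proof (rule ccontr)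
  assume contra: "\<not> ?thesis"
  have diff: "\<phi> differentiable at y" if "y \<in> S" for y
    using \<phi> that by (simp add: numeral_2_eq_2)
  have \<phi>_grad: "(\<phi> has_derivative (\<lambda>h. h \<bullet> grad \<phi> y)) (at y)" if "y \<in> S" for y
  proof -
    let ?L = "frechet_derivative \<phi> (at y)"
    have L: "(\<phi> has_derivative ?L) (at y)"
      using diff[OF that] frechet_derivative_works by blast
    have "?L h = h \<bullet> grad \<phi> y" for h
    proof -
      have "?L h = ?L (\<Sum>i\<in>UNIV. h $ i *\<^sub>R axis i 1)"
        using basis_expansion[of h] by (simp add: scalar_mult_eq_scaleR)
      also have "\<dots> = (\<Sum>i\<in>UNIV. h $ i * ?L (axis i 1))"
        using has_derivative_linear[OF L] by (simp add: linear_sum linear_cmul)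
      also have "\<dots> = h \<bullet> grad \<phi> y"
        by (simp add: inner_vec_def grad_def)
      finally show ?thesis .
    qed
    then have "?L = (\<lambda>h. h \<bullet> grad \<phi> y)" ..
    with L show ?thesis by simp
  qed
  have "(\<lambda>y. grad \<phi> y $ i) differentiable at x" for i
    using \<phi> \<open>x \<in> S\<close> by (simp add: numeral_2_eq_2)
  then have "grad \<phi> differentiable at x"
    unfolding differentiable_componentwise_within[of "grad \<phi>"]
    by (auto simp: Basis_vec_def inner_axis)
  then have L: "(grad \<phi> has_derivative frechet_derivative (grad \<phi>) (at x)) (at x)"
    using frechet_derivative_works by blast
  let ?L = "frechet_derivative (grad \<phi>) (at x)"
  have L_eq: "hessian \<phi> x *v v = ?L v"
    unfolding hessian_def by (rule matrix_works) (use has_derivative_linear[OF L] in \<open>simp add: linear_matrix_vector_mul_eq\<close>)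
  let ?q = "\<lambda>t. \<phi> (x + t *\<^sub>R v) + \<phi> (x - t *\<^sub>R v)"
  let ?q' = "\<lambda>t. v \<bullet> grad \<phi> (x + t *\<^sub>R v) - v \<bullet> grad \<phi> (x - t *\<^sub>R v)"
  have lim_x: "((\<lambda>t. x + t *\<^sub>R v) \<longlongrightarrow> x) (at 0)" "((\<lambda>t. x - t *\<^sub>R v) \<longlongrightarrow> x) (at 0)"
    by (auto intro!: tendsto_eq_intros)
  have q': "(?q has_real_derivative ?q' t) (at t)" if "x + t *\<^sub>R v \<in> S" "x - t *\<^sub>R v \<in> S" for t
  proof -
    have "((\<lambda>t. \<phi> (x + t *\<^sub>R v)) has_derivative (\<lambda>s. (s *\<^sub>R v) \<bullet> grad \<phi> (x + t *\<^sub>R v))) (at t)"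
      by (rule has_derivative_compose[where f = "\<lambda>t. x + t *\<^sub>R v", OF _ \<phi>_grad[OF that(1)]]) (auto intro!: derivative_eq_intros)
    moreover have "((\<lambda>t. \<phi> (x - t *\<^sub>R v)) has_derivative (\<lambda>s. (- (s *\<^sub>R v)) \<bullet> grad \<phi> (x - t *\<^sub>R v))) (at t)"
      by (rule has_derivative_compose[where f = "\<lambda>t. x - t *\<^sub>R v", OF _ \<phi>_grad[OF that(2)]]) (auto intro!: derivative_eq_intros)
    ultimately have "(?q has_derivative (\<lambda>s. (s *\<^sub>R v) \<bullet> grad \<phi> (x + t *\<^sub>R v) + (- (s *\<^sub>R v)) \<bullet> grad \<phi> (x - t *\<^sub>R v))) (at t)"
      by (rule has_derivative_add)
    moreover have "(\<lambda>s. (s *\<^sub>R v) \<bullet> grad \<phi> (x + t *\<^sub>R v) + (- (s *\<^sub>R v)) \<bullet> grad \<phi> (x - t *\<^sub>R v)) = (*) (?q' t)"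
      by (auto simp: fun_eq_iff algebra_simps)
    ultimately show ?thesis
      by (simp add: has_field_derivative_def)
  qed
  \<comment> \<open>Both halves of \<open>?q'\<close> contribute \<open>v \<bullet> ?L v\<close>.
    Were the quadratic form above \<open>K\<close>, this derivative would be positive; since
    \<open>?q' t - 2 * K * t\<close> vanishes at \<open>0\<close>,
    \<open>?q t - K * t\<^sup>2\<close> would then increase strictly to the right of
    \<open>0\<close>, against \<open>le\<close>.\<close>
  have D0: "((\<lambda>t. ?q' t - 2 * K * t) has_real_derivative 2 * (v \<bullet> ?L v) - 2 * K) (at 0)"
  proof -
    have L0: "(grad \<phi> has_derivative ?L) (at (x + 0 *\<^sub>R v))" "(grad \<phi> has_derivative ?L) (at (x - 0 *\<^sub>R v))"
      using L by simp_all
    have lin: "linear ?L"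
      using has_derivative_linear[OF L] .
    have "((\<lambda>t. grad \<phi> (x + t *\<^sub>R v)) has_derivative (\<lambda>s. ?L (s *\<^sub>R v))) (at 0)"
      by (rule has_derivative_compose[where f = "\<lambda>t. x + t *\<^sub>R v", OF _ L0(1)]) (auto intro!: derivative_eq_intros)
    moreover have "((\<lambda>t. grad \<phi> (x - t *\<^sub>R v)) has_derivative (\<lambda>s. ?L (- (s *\<^sub>R v)))) (at 0)"
      by (rule has_derivative_compose[where f = "\<lambda>t. x - t *\<^sub>R v", OF _ L0(2)]) (auto intro!: derivative_eq_intros)
    ultimately have "((\<lambda>t. ?q' t - 2 * K * t) has_derivative (\<lambda>s. v \<bullet> ?L (s *\<^sub>R v) - v \<bullet> ?L (- (s *\<^sub>R v)) - 2 * K * s)) (at 0)"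
      by (intro has_derivative_diff has_derivative_inner_right has_derivative_mult_right has_derivative_ident)
    moreover have "(\<lambda>s. v \<bullet> ?L (s *\<^sub>R v) - v \<bullet> ?L (- (s *\<^sub>R v)) - 2 * K * s) = (*) (2 * (v \<bullet> ?L v) - 2 * K)"
      using lin by (auto simp: fun_eq_iff linear_cmul linear_neg algebra_simps)
    ultimately show ?thesis
      by (simp add: has_field_derivative_def)
  qed
  have "0 < 2 * (v \<bullet> ?L v) - 2 * K"
    using contra L_eq by simp
  from DERIV_pos_inc_right[OF D0 this]
  obtain d1 where "d1 > 0" "\<forall>h>0. h < d1 \<longrightarrow> ?q' 0 - 2 * K * 0 < ?q' (0 + h) - 2 * K * (0 + h)"
    by blast
  then have d1: "d1 > 0" "\<And>t. 0 < t \<Longrightarrow> t < d1 \<Longrightarrow> 0 < ?q' t - 2 * K * t"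
    by simp_all
  have "\<forall>\<^sub>F t in at 0. x + t *\<^sub>R v \<in> S \<and> x - t *\<^sub>R v \<in> S"
    by (rule eventually_conj[OF topological_tendstoD[OF lim_x(1) assms(1,2)]
          topological_tendstoD[OF lim_x(2) assms(1,2)]])
  then obtain d2 where d2: "d2 > 0" "\<And>t. t \<noteq> 0 \<Longrightarrow> \<bar>t\<bar> < d2 \<Longrightarrow> x + t *\<^sub>R v \<in> S \<and> x - t *\<^sub>R v \<in> S"
    by (auto simp: eventually_at dist_real_def)
  obtain d3 where d3: "d3 > 0" "\<And>t. 0 < t \<Longrightarrow> t < d3 \<Longrightarrow> ?q t - 2 * \<phi> x \<le> K * t\<^sup>2"
    using le by (auto simp: eventually_at_right_field)
  define t where "t = Min {d1, d2, d3} / 2"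
  have t: "0 < t" "t < d1" "t < d2" "t < d3"
    using d1 d2 d3 by (auto simp: t_def min_def)
  let ?w = "\<lambda>s. ?q s - K * s\<^sup>2"
  have deriv_w: "(?w has_real_derivative ?q' s - 2 * K * s) (at s)" if "0 \<le> s" "s \<le> t" for s
  proof -
    have "x + s *\<^sub>R v \<in> S" "x - s *\<^sub>R v \<in> S"
      using d2(2)[of s] that t \<open>x \<in> S\<close> by (cases "s = 0"; simp)+
    then have "(?w has_real_derivative ?q' s - K * (2 * s)) (at s)"
      by (intro DERIV_diff q') (auto intro!: derivative_eq_intros)
    then show ?thesis
      by (simp add: algebra_simps)
  qed
  have "?w 0 < ?w t"
  proof (rule DERIV_pos_imp_increasing_open[OF t(1)])
    show "\<exists>y. (?w has_real_derivative y) (at s) \<and> 0 < y" if "0 < s" "s < t" for s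
      using deriv_w[of s] d1(2)[of s] that t by (intro exI[of _ "?q' s - 2 * K * s"] conjI) auto
    show "continuous_on {0..t} ?w"
      by (intro continuous_at_imp_continuous_on ballI DERIV_isCont[OF deriv_w]) auto
  qed
  then show False
    using d3(2)[of t] t by simp
qed

text \<open>At a local minimum of \<open>u - \<phi>\<close> the increments of \<open>\<phi>\<close>
  are at most those of \<open>u\<close>, so \<open>\<phi>\<close> inherits the bound on small second
  differences with the same constant.\<close>

lemma semiconcave_imp_viscosity_neg_hessian_ge:
  fixes u :: "real^'n \<Rightarrow> real"
  assumes "open \<Omega>"
    and sc: "\<And>x h. closed_segment (x - h) (x + h) \<subseteq> \<Omega> \<Longrightarrow>
        u (x + h) - 2 * u x + u (x - h) \<le> K * (norm h)\<^sup>2"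
  shows "viscosity_neg_hessian_ge \<Omega> u K"
  unfolding viscosity_neg_hessian_ge_def loewner_le_def
proof (intro allI impI, elim conjE)
  fix \<phi> x v assume \<phi>: "smooth_on \<Omega> \<phi>" and min: "local_min_rel \<Omega> (\<lambda>y. u y - \<phi> y) x"
  have "x \<in> \<Omega>"
    using min by (simp add: local_min_rel_def)
  have "\<forall>\<^sub>F y in at x. u x - \<phi> x \<le> u y - \<phi> y"
    using min at_within_open[OF \<open>x \<in> \<Omega>\<close> \<open>open \<Omega>\<close>] by (simp add: local_min_rel_def)
  then have ev: "\<forall>\<^sub>F y in nhds x. u x - \<phi> x \<le> u y - \<phi> y"
    unfolding eventually_at_filter by (auto elim!: eventually_mono)
  obtain r where r: "r > 0" "ball x r \<subseteq> \<Omega>"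
    using \<open>open \<Omega>\<close> \<open>x \<in> \<Omega>\<close> open_contains_ball by blast
  have lim: "((\<lambda>t. x + t *\<^sub>R v) \<longlongrightarrow> x) (at_right 0)" "((\<lambda>t. x - t *\<^sub>R v) \<longlongrightarrow> x) (at_right 0)"
    by (auto intro!: tendsto_eq_intros)
  have "\<forall>\<^sub>F y in nhds x. y \<in> ball x r"
    using r by (intro eventually_nhds_in_open) auto
  then have "\<forall>\<^sub>F y in nhds x. y \<in> ball x r \<and> u x - \<phi> x \<le> u y - \<phi> y"
    using ev by eventually_elim auto
  from this[THEN eventually_compose_filterlim, OF lim(1)] this[THEN eventually_compose_filterlim, OF lim(2)]
  have "\<forall>\<^sub>F t in at_right 0. \<phi> (x + t *\<^sub>R v) + \<phi> (x - t *\<^sub>R v) - 2 * \<phi> x \<le> K * (norm v)\<^sup>2 * t\<^sup>2"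
  proof eventually_elim
    case (elim t)
    then have "closed_segment (x - t *\<^sub>R v) (x + t *\<^sub>R v) \<subseteq> ball x r"
      by (intro closed_segment_subset) auto
    then have "u (x + t *\<^sub>R v) - 2 * u x + u (x - t *\<^sub>R v) \<le> K * (norm (t *\<^sub>R v))\<^sup>2"
      using r by (intro sc) auto
    then show ?case
      using elim by (simp add: power_mult_distrib algebra_simps)
  qed
  then have "v \<bullet> (hessian \<phi> x *v v) \<le> K * (norm v)\<^sup>2"
    using \<phi> \<open>x \<in> \<Omega>\<close> by (intro hessian_quadratic_form_le[OF \<open>open \<Omega>\<close>]) (auto simp: smooth_on_def)
  then show "v \<bullet> (hessian \<phi> x *v v) \<le> v \<bullet> ((K *\<^sub>R mat 1) *v v)"
    by (simp add: power2_norm_eq_inner scaleR_matrix_vector_assoc[symmetric])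
qed

section \<open>Boundary values, extension to the whole space and conclusion\<close>

lemma continuous_on_zero_extension:
  fixes g :: "'a::topological_space \<Rightarrow> 'b::real_normed_vector"
  assumes "open \<Omega>" and "continuous_on (closure \<Omega>) g" and "\<And>x. x \<in> frontier \<Omega> \<Longrightarrow> g x = 0"
  shows "continuous_on UNIV (\<lambda>x. if x \<in> \<Omega> then g x else 0)"
proof -
  have "continuous_on (closure \<Omega> \<union> - \<Omega>) (\<lambda>x. if x \<in> \<Omega> then g x else 0)"
    using assms by (intro continuous_on_cases) (auto simp: frontier_def interior_open)
  moreover have "closure \<Omega> \<union> - \<Omega> = UNIV"
    using closure_subset by blast
  ultimately show ?thesis by simp
qed

theorem corollary3p2:
  fixes \<Omega> :: "(real^'n) set"
    and p :: real
    and f u :: "real^'n \<Rightarrow> real"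
    and Df :: "real^'n \<Rightarrow> real^'n"
    and H :: "real^'n \<Rightarrow> real^'n \<Rightarrow> real"
  assumes "open \<Omega>" and "bounded \<Omega>" and "connected \<Omega>" and "\<Omega> \<noteq> {}" and "C2_boundary \<Omega>"
    and "1 < p" and "p \<le> 2"
    and "C1_closure \<Omega> f Df"
    and "semiconcave_in \<Omega> f"
    and "\<And>x \<beta>. H x \<beta> = norm \<beta> powr p - f x"
    and "\<forall>x\<in>frontier \<Omega>. f x = (INF y\<in>closure \<Omega>. f y)"
    and "\<forall>x\<in>\<Omega>. f x > (INF y\<in>closure \<Omega>. f y)"
    and "\<exists>C>0. \<forall>x\<in>\<Omega>. norm (Df x) \<le> C * (f x - (INF y\<in>closure \<Omega>. f y)) powr (1 / p)"
    and "constrained_viscosity_solution \<Omega> H u"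
  shows "\<exists>C. viscosity_neg_hessian_ge \<Omega> u C \<and>
    (\<forall>x h. closed_segment (x - h) (x + h) \<subseteq> \<Omega> \<longrightarrow>
       u (x + h) - 2 * u x + u (x - h) \<le> C * (norm h)\<^sup>2)"
proof -
  define m where "m = (INF y\<in>closure \<Omega>. f y)"
  note sol = assms(14)
  have f: "continuous_on (closure \<Omega>) f" and Df: "continuous_on (closure \<Omega>) Df"
    and f_Df: "\<And>x. x \<in> \<Omega> \<Longrightarrow> GDERIV f x :> Df x"
    using assms(8) by (auto simp: C1_closure_def)
  have u: "continuous_on (closure \<Omega>) u"
    using sol by (simp add: constrained_viscosity_solution_def)
  have comp: "compact (closure \<Omega>)" "closure \<Omega> \<noteq> {}"
    using assms(2,4) by (auto simp: compact_closure closure_eq_empty)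
  have f_frontier: "f x = m" if "x \<in> frontier \<Omega>" for x
    using assms(11) that by (simp add: m_def)
  have f_ge: "m \<le> f x" if "x \<in> closure \<Omega>" for x
    using that f_frontier[of x] assms(1,12)
    by (cases "x \<in> \<Omega>") (auto simp: m_def frontier_def interior_open less_imp_le)
  obtain C where C: "\<And>x. x \<in> \<Omega> \<Longrightarrow> norm (Df x) \<le> C * (f x - m) powr (1 / p)"
    using assms(13) by (auto simp: m_def)
  \<comment> \<open>The gradient bound passes to the closure by continuity, and its right-hand side
    vanishes where \<open>f = m\<close>, since \<open>0 powr (1 / p)\<close> is
    \<open>0\<close>.\<close>
  have Df_frontier: "Df x = 0" if "x \<in> frontier \<Omega>" for x
  proof -
    have "continuous_on (closure \<Omega>) (\<lambda>x. norm (Df x) - C * (f x - m) powr (1 / p))"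
      using f_ge \<open>1 < p\<close> by (intro continuous_intros continuous_on_powr' f Df) auto
    moreover have "x \<in> closure \<Omega>"
      using that by (simp add: frontier_def)
    ultimately have "norm (Df x) - C * (f x - m) powr (1 / p) \<le> 0"
      using continuous_le_on_closure C by (metis (no_types, lifting) diff_le_0_iff_le)
    then show ?thesis
      using f_frontier[OF that] by simp
  qed
  have u_le: "u x \<le> f x" if "x \<in> closure \<Omega>" for x
  proof -
    have u_le_inside: "u y \<le> f y" if "y \<in> \<Omega>" for y
      by (rule viscosity_subsolution_pointwise[OF sol assms(1)
            continuous_on_subset[OF f closure_subset] _ that]) (simp add: assms(10))
    have "u x - f x \<le> 0"
      by (rule continuous_le_on_closure[OF continuous_on_diff[OF u f] that]) (simp add: u_le_inside)
    then show ?thesis by simp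
  qed
  have u_ge: "m \<le> u x" if "x \<in> closure \<Omega>" for x
  proof -
    \<comment> \<open>The minimum point \<open>a\<close> of \<open>u\<close> may lie on the
      boundary, where the supersolution condition still holds. Testing with a constant there gives
      \<open>f a <= u a\<close>.\<close>
    obtain a where a: "a \<in> closure \<Omega>" "\<And>y. y \<in> closure \<Omega> \<Longrightarrow> u a \<le> u y"
      using continuous_attains_inf[OF comp u] by blast
    have "0 \<le> u a + H a ((2 * 0) *\<^sub>R (a - 0))"
      using a by (intro viscosity_supersolution_quadratic[OF sol]) auto
    then have "f a \<le> u a"
      using assms(10) by simp
    then show ?thesis
      using f_ge[OF a(1)] a(2)[OF that] by simp
  qed
  have u_frontier: "u x = m" if "x \<in> frontier \<Omega>" for x
    using that u_le[of x] u_ge[of x] f_frontier[of x] by (auto simp: frontier_def)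
  obtain K where K: "K \<ge> 0" "\<And>x h. closed_segment (x - h) (x + h) \<subseteq> \<Omega> \<Longrightarrow>
      f (x + h) + f (x - h) - 2 * f x \<le> K * (norm h)\<^sup>2"
    using assms(9) by (auto simp: semiconcave_in_def)
  have seg: "x + h \<in> \<Omega> \<and> x - h \<in> \<Omega> \<and> x \<in> \<Omega>" if "closed_segment (x - h) (x + h) \<subseteq> \<Omega>" for x h
  proof -
    have "x = midpoint (x - h) (x + h)"
      by (simp add: midpoint_def flip: scaleR_2)
    then have "x \<in> closed_segment (x - h) (x + h)"
      by (metis midpoint_in_closed_segment)
    then show ?thesis
      using that by auto
  qed
  define F where "F = (\<lambda>x. if x \<in> \<Omega> then f x - m else 0)"
  define U where "U = (\<lambda>x. if x \<in> \<Omega> then u x - m else 0)"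
  define G where "G = (\<lambda>x. if x \<in> \<Omega> then Df x else 0)"
  have F_cont: "continuous_on UNIV F" and U_cont: "continuous_on UNIV U" and G_cont: "continuous_on UNIV G"
    unfolding F_def U_def G_def using f u Df f_frontier u_frontier Df_frontier
    by (intro continuous_on_zero_extension assms(1) continuous_intros; simp)+
  have U_nonneg: "U x \<ge> 0" for x
    using u_ge[of x] closure_subset by (auto simp: U_def)
  have F_sc: "F (x + h) + F (x - h) - 2 * F x \<le> K * (norm h)\<^sup>2" for x h
  proof (rule zero_extension_semiconcave[OF assms(1) F_cont G_cont])
    show "GDERIV F x :> G x" if "x \<in> \<Omega>" for x
    proof -
      have "((\<lambda>x. f x - m) has_derivative (\<lambda>h. h \<bullet> Df x)) (at x)"
        using f_Df[OF that] by (auto simp: gderiv_def intro!: derivative_eq_intros)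
      then have "(F has_derivative (\<lambda>h. h \<bullet> Df x)) (at x)"
        by (rule has_derivative_transform_within_open[OF _ assms(1) that]) (simp add: F_def)
      then show ?thesis
        using that by (simp add: gderiv_def G_def)
    qed
    show "F (x + h) + F (x - h) - 2 * F x \<le> K * (norm h)\<^sup>2"
      if "closed_segment (x - h) (x + h) \<subseteq> \<Omega>" for x h
      using K(2)[OF that] seg[OF that] by (simp add: F_def)
  qed (auto simp: F_def G_def K(1))
  have U_sc: "U (x + h) + U (x - h) - 2 * U x \<le> K * (norm h)\<^sup>2" for x h
  proof (rule semiconcave_of_convex_Hamilton_Jacobi[OF assms(2) _ K(1) U_cont F_cont U_nonneg _ F_sc])
    show "1 \<le> p" using assms(6) by simp
    fix x a :: "real^'n" and c :: real assume "c > 0"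
    show "U x + norm ((2 * c) *\<^sub>R (x - a)) powr p \<le> F x"
      if max: "\<And>y. U y - c * (norm (y - a))\<^sup>2 \<le> U x - c * (norm (x - a))\<^sup>2"
    proof (cases "x \<in> \<Omega>")
      case True
      have "\<forall>\<^sub>F y in nhds x. y \<in> \<Omega>"
        using assms(1) True by (rule eventually_nhds_in_open)
      then have "\<forall>\<^sub>F y in nhds x. u y - c * (norm (y - a))\<^sup>2 \<le> u x - c * (norm (x - a))\<^sup>2"
      proof eventually_elim
        case (elim y)
        then show ?case
          using max[of y] True by (simp add: U_def)
      qed
      then have "u x + H x ((2 * c) *\<^sub>R (x - a)) \<le> 0"
        by (rule viscosity_subsolution_quadratic[OF sol assms(1) True])
      then show ?thesis
        using True by (simp add: assms(10) U_def F_def)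
    next
      case False
      \<comment> \<open>Off \<open>\<Omega>\<close> the paraboloid touches the minimum value \<open>0\<close> of \<open>U\<close>, so it has zero gradient there.\<close>
      have "c * (norm (x - a))\<^sup>2 \<le> 0"
        using max[of a] U_nonneg[of a] False by (simp add: U_def split: if_splits)
      then have "x = a"
        using \<open>c > 0\<close> by (simp add: mult_le_0_iff)
      then show ?thesis
        using False by (simp add: U_def F_def)
    qed
    show "F x \<le> U x + norm ((2 * c) *\<^sub>R (a - x)) powr p"
      if min: "\<And>y. U x + c * (norm (x - a))\<^sup>2 \<le> U y + c * (norm (y - a))\<^sup>2"
    proof (cases "x \<in> \<Omega>")
      case True
      \<comment> \<open>Since \<open>u = m\<close> on the boundary, \<open>U\<close> and
        \<open>u - m\<close> agree on the whole closure. A global minimum for \<open>U\<close> is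
        thus one relative to the closure for \<open>u\<close>, as the constrained condition
        requires.\<close>
      have U_closure: "U y = u y - m" if "y \<in> closure \<Omega>" for y
        using that u_frontier[of y] assms(1) by (auto simp: U_def frontier_def interior_open)
      have x: "x \<in> closure \<Omega>"
        using True closure_subset by blast
      have "0 \<le> u x + H x ((2 * (- c)) *\<^sub>R (x - a))"
      proof (rule viscosity_supersolution_quadratic[OF sol x])
        show "u x - - c * (norm (x - a))\<^sup>2 \<le> u y - - c * (norm (y - a))\<^sup>2" if "y \<in> closure \<Omega>" for y
          using min[of y] U_closure[OF that] U_closure[OF x] by simp
      qed
      then show ?thesis
        using True by (simp add: assms(10) U_def F_def norm_minus_commute[of a x])
    qed (simp add: U_def F_def)
  qed (auto simp: U_def F_def)
  \<comment> \<open>On a segment inside \<open>\<Omega>\<close> the shifts by \<open>m\<close>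
    cancel, so \<open>K\<close> is kept. The viscosity inequality is deduced from this bound, so one
    constant serves both claims.\<close>
  have u_sc: "u (x + h) - 2 * u x + u (x - h) \<le> K * (norm h)\<^sup>2"
    if "closed_segment (x - h) (x + h) \<subseteq> \<Omega>" for x h
    using U_sc[of x h] seg[OF that] by (simp add: U_def)
  then show ?thesis
    using semiconcave_imp_viscosity_neg_hessian_ge[OF assms(1)] by blast
qed

end
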